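(* For all $x,y\in\mathcal{M}$: $$\tilde\Delta_{\mathcal{A}ss}(xy)=(x\otimes1)\tilde\Delta_{\mathcal{A}ss}(y)+\tilde\Delta_{\mathcal{A}ss}(x)(1\otimes y)+x\otimes y,$$ $$\tilde\Delta_{\mathcal{A}ss}(x\succ y)=(x\otimes1)\succ\tilde\Delta_{\mathcal{A}ss}(y),$$ $$\tilde\Delta_{\mathcal{A}ss}(x\prec y)=\tilde\Delta_{\mathcal{A}ss}(x)\prec(1\otimes y).$$
   Context: $\mathbb{K}$ is a commutative field of any characteristic. We consider planar rooted forests (finite ordered sequences of planar rooted trees) whose edges are decorated by $l$ or $r$; $1$ is the empty forest. For two such forests $F,G$, $B(F\otimes G)$ is the tree obtained by grafting the roots of the trees of $F$ followed by those of $G$ (in this left-to-right order) on a common new root, the edges from the new root to the roots of $F$ being decorated by $l$ and those to the roots of $G$ by $r$. Let $\mathbb{T}$ be the set consisting of $1$ and of the trees obtained inductively as $B(F_1\cdots F_p\otimes G_1\cdots G_q)$, $p,q\ge 0$, with all $F_i,G_j$ nonempty trees already in $\mathbb{T}$; $\mathbb{F}$ is the set of forests all of whose trees are in $\mathbb{T}$ (including $1$). $\mathcal{M}$ is the vector space with basis $\mathbb{F}\setminus\{1\}$, with the concatenation product and the operations defined, for $F=F_1\cdots F_n$, $G=G_1\cdots G_k$ in $\mathbb{F}\setminus\{1\}$ (the $F_i,G_j$ nonempty trees) with $F_1=B(F_1^1\otimes F_1^2)$, $G_k=B(G_k^1\otimes G_k^2)$, by $G\succ F=B(GF_1^1\otimes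 F_1^2)F_2\cdots F_n$ and $G\prec F=G_1\cdots G_{k-1}B(G_k^1\otimes G_k^2F)$, extended bilinearly. $\tilde\Delta_{\mathcal{A}ss}:\mathcal{M}\to\mathcal{M}\otimes\mathcal{M}$ is the reduced deconcatenation: for $F\in\mathbb{F}\setminus\{1\}$, $\tilde\Delta_{\mathcal{A}ss}(F)=\sum F_1\otimes F_2$ over pairs $F_1,F_2\in\mathbb{F}\setminus\{1\}$ with $F_1F_2=F$. On tensors the conventions used are: $(x\otimes1)(y'\otimes y'')=xy'\otimes y''$, $(x'\otimes x'')(1\otimes y)=x'\otimes x''y$, $(x\otimes1)\succ(y'\otimes y'')=(x\succ y')\otimes y''$, $(x'\otimes x'')\prec(1\otimes y)=x'\otimes(x''\prec y)$. *)

theory Defs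
  imports Complex_Main "HOL-Library.Poly_Mapping"
begin

section \<open>Trees and forests\<close>

text \<open>
  The nonempty trees of the set T are those freely generated by the grafting operator B.
  The constructor \<open>B F G\<close> is the tree whose root carries the trees of \<open>F\<close> along edges
  decorated by l, followed by the trees of \<open>G\<close> along edges decorated by r.
  A forest is a list of trees, and the empty forest 1 is \<open>[]\<close>.
\<close>

datatype tree = B (lpart: "tree list") (rpart: "tree list")

text \<open>
  The constants of this paragraph are not used below. They relate the datatype to arbitrary
  planar trees with decorated edges: \<open>to_dtree\<close> identifies \<open>tree\<close> with the set T, defined as
  an inductive set of such trees.
\<close>

datatype edge = El | Er

datatype dtree = Node "(edge \<times> dtree) list"

definition graft :: "dtree list \<Rightarrow> dtree list \<Rightarrow> dtree" where
  "graft F G = Node (map (Pair El) F @ map (Pair Er) G)"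

inductive_set T_trees :: "dtree set" where
  "\<lbrakk>\<forall>t \<in> set F. t \<in> T_trees; \<forall>t \<in> set G. t \<in> T_trees\<rbrakk> \<Longrightarrow> graft F G \<in> T_trees"

primrec to_dtree :: "tree \<Rightarrow> dtree" where
  "to_dtree (B F G) = graft (map to_dtree F) (map to_dtree G)"

lemma graft_inject: "graft F G = graft F' G' \<longleftrightarrow> F = F' \<and> G = G'"
proof
  assume "graft F G = graft F' G'"
  then have eq: "map (Pair El) F @ map (Pair Er) G = map (Pair El) F' @ map (Pair Er) G'"
    by (simp add: graft_def)
  have l: "map snd (filter (\<lambda>e. fst e = El) (map (Pair El) F @ map (Pair Er) G)) = F" for F G :: "dtree list"
    by (simp add: filter_map comp_def)
  have r: "map snd (filter (\<lambda>e. fst e = Er) (map (Pair El) F @ map (Pair Er) G)) = G" for F G :: "dtree list"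
    by (simp add: filter_map comp_def)
  show "F = F' \<and> G = G'"
    using l[of F G] l[of F' G'] r[of F G] r[of F' G'] unfolding eq by argo
qed simp

lemma to_dtree_in_T: "to_dtree t \<in> T_trees"
  by (induction t) (auto intro!: T_trees.intros)

lemma to_dtree_inject: "to_dtree s = to_dtree t \<Longrightarrow> s = t"
proof (induction s arbitrary: t)
  case (B F G)
  obtain F' G' where t: "t = B F' G'" by (cases t)
  from B.prems have "map to_dtree F = map to_dtree F'" "map to_dtree G = map to_dtree G'"
    by (simp_all add: t graft_inject)
  with B.IH have "F = F'" "G = G'"
    by (metis list.inj_map_strong)+
  then show ?case by (simp add: t)
qed

lemma T_trees_subset: "d \<in> T_trees \<Longrightarrow> d \<in> range to_dtree"
proof (induction rule: T_trees.induct)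
  case (1 F G)
  then have "F \<in> range (map to_dtree)" "G \<in> range (map to_dtree)"
    by (auto simp: image_iff ex_map_conv)
  then obtain F' G' where "F = map to_dtree F'" "G = map to_dtree G'"
    by blast
  then have "graft F G = to_dtree (B F' G')" by simp
  then show ?case by blast
qed

lemma bij_to_dtree: "bij_betw to_dtree UNIV T_trees"
  using to_dtree_in_T T_trees_subset
  by (auto simp: bij_betw_def inj_on_def dest: to_dtree_inject)

typedef nforest = "{F :: tree list. F \<noteq> []}"
  by auto

setup_lifting type_definition_nforest

lift_definition conc_nf :: "nforest \<Rightarrow> nforest \<Rightarrow> nforest" is "(@)"
  by simp

text \<open>In both operations the arguments appear in the order in which they are written:
  \<open>succ_nf G F\<close> is \<open>G \<succ> F\<close> and \<open>prec_nf G F\<close> is \<open>G \<prec> F\<close>.\<close>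

lift_definition succ_nf :: "nforest \<Rightarrow> nforest \<Rightarrow> nforest" is
  "\<lambda>G F. B (G @ lpart (hd F)) (rpart (hd F)) # tl F"
  by simp

lift_definition prec_nf :: "nforest \<Rightarrow> nforest \<Rightarrow> nforest" is
  "\<lambda>G F. butlast G @ [B (lpart (last G)) (rpart (last G) @ F)]"
  by simp


section \<open>Free vector spaces and their tensor products\<close>

text \<open>
  The vector space with basis \<open>'a\<close> over \<open>'k\<close> is \<open>'a \<Rightarrow>\<^sub>0 'k\<close>, the basis vector of \<open>a\<close> being
  \<open>Poly_Mapping.single a 1\<close>. The tensor product of the spaces with bases \<open>'a\<close> and \<open>'b\<close> is the
  space with basis \<open>'a \<times> 'b\<close>.
\<close>

definition scale :: "'k::field \<Rightarrow> ('a \<Rightarrow>\<^sub>0 'k) \<Rightarrow> ('a \<Rightarrow>\<^sub>0 'k)" where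
  "scale c = Poly_Mapping.map ((*) c)"

definition lin_ext :: "('a \<Rightarrow> ('c \<Rightarrow>\<^sub>0 'k::field)) \<Rightarrow> ('a \<Rightarrow>\<^sub>0 'k) \<Rightarrow> ('c \<Rightarrow>\<^sub>0 'k)" where
  "lin_ext f x = (\<Sum>a\<in>Poly_Mapping.keys x. scale (Poly_Mapping.lookup x a) (f a))"

definition bilin_ext :: "('a \<Rightarrow> 'b \<Rightarrow> 'c) \<Rightarrow> ('a \<Rightarrow>\<^sub>0 'k::field) \<Rightarrow> ('b \<Rightarrow>\<^sub>0 'k) \<Rightarrow> ('c \<Rightarrow>\<^sub>0 'k)" where
  "bilin_ext f x y = lin_ext (\<lambda>a. lin_ext (\<lambda>b. Poly_Mapping.single (f a b) 1) y) x"

definition tensor :: "('a \<Rightarrow>\<^sub>0 'k::field) \<Rightarrow> ('b \<Rightarrow>\<^sub>0 'k) \<Rightarrow> ('a \<times> 'b \<Rightarrow>\<^sub>0 'k)" (infixr "\<otimes>" 75) where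
  "x \<otimes> y = bilin_ext Pair x y"

text \<open>\<open>on_left h\<close> is \<open>h \<otimes> id\<close> and \<open>on_right h\<close> is \<open>id \<otimes> h\<close>, for a linear map \<open>h\<close>.\<close>

definition on_left :: "(('a \<Rightarrow>\<^sub>0 'k::field) \<Rightarrow> ('c \<Rightarrow>\<^sub>0 'k)) \<Rightarrow> ('a \<times> 'b \<Rightarrow>\<^sub>0 'k) \<Rightarrow> ('c \<times> 'b \<Rightarrow>\<^sub>0 'k)" where
  "on_left h = lin_ext (\<lambda>(a, b). h (Poly_Mapping.single a 1) \<otimes> Poly_Mapping.single b 1)"

definition on_right :: "(('b \<Rightarrow>\<^sub>0 'k::field) \<Rightarrow> ('c \<Rightarrow>\<^sub>0 'k)) \<Rightarrow> ('a \<times> 'b \<Rightarrow>\<^sub>0 'k) \<Rightarrow> ('a \<times> 'c \<Rightarrow>\<^sub>0 'k)" where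
  "on_right h = lin_ext (\<lambda>(a, b). Poly_Mapping.single a 1 \<otimes> h (Poly_Mapping.single b 1))"

lemma lookup_scale [simp]: "Poly_Mapping.lookup (scale c x) a = c * Poly_Mapping.lookup x a"
  by (auto simp: scale_def Poly_Mapping.map.rep_eq when_def)

lemma vector_space_scale: "vector_space (scale :: 'k::field \<Rightarrow> ('a \<Rightarrow>\<^sub>0 'k) \<Rightarrow> _)"
  by unfold_locales (auto intro!: poly_mapping_eqI simp: lookup_add algebra_simps)

lemma lin_ext_superset:
  assumes "finite A" "Poly_Mapping.keys x \<subseteq> A"
  shows "lin_ext f x = (\<Sum>a\<in>A. scale (Poly_Mapping.lookup x a) (f a))"
  unfolding lin_ext_def
  by (rule sum.mono_neutral_left)
     (use assms in \<open>auto intro!: poly_mapping_eqI simp: in_keys_iff\<close>)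

lemma lin_ext_add: "lin_ext f (x + y) = lin_ext f x + lin_ext f y"
proof -
  let ?A = "Poly_Mapping.keys x \<union> Poly_Mapping.keys y"
  have "Poly_Mapping.keys (x + y) \<subseteq> ?A" by (rule Poly_Mapping.keys_add)
  then show ?thesis
    by (auto simp: lin_ext_superset[of ?A] lookup_add lookup_sum distrib_right sum.distrib
             intro!: poly_mapping_eqI)
qed

lemma lin_ext_scale: "lin_ext f (scale c x) = scale c (lin_ext f x)"
proof -
  have "Poly_Mapping.keys (scale c x) \<subseteq> Poly_Mapping.keys x" by (auto simp: in_keys_iff)
  then show ?thesis
    by (auto simp: lin_ext_superset[of "Poly_Mapping.keys x"] lookup_sum sum_distrib_left mult.assoc
             intro!: poly_mapping_eqI)
qed

lemma linear_lin_ext: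
  "Vector_Spaces.linear scale scale (lin_ext f :: ('a \<Rightarrow>\<^sub>0 'k::field) \<Rightarrow> ('c \<Rightarrow>\<^sub>0 'k))"
proof -
  interpret V: vector_space "scale :: 'k \<Rightarrow> ('a \<Rightarrow>\<^sub>0 'k) \<Rightarrow> _" by (rule vector_space_scale)
  interpret W: vector_space "scale :: 'k \<Rightarrow> ('c \<Rightarrow>\<^sub>0 'k) \<Rightarrow> _" by (rule vector_space_scale)
  show ?thesis
    by unfold_locales (rule lin_ext_add lin_ext_scale)+
qed

lemma lin_ext_single [simp]: "lin_ext f (Poly_Mapping.single a 1) = f a"
  by (rule poly_mapping_eqI) (simp add: lin_ext_def)

lemma bilin_ext_single [simp]:
  "bilin_ext f (Poly_Mapping.single a 1) (Poly_Mapping.single b 1) = Poly_Mapping.single (f a b) 1"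
  by (simp add: bilin_ext_def)

lemma linear_bilin_ext_left: "Vector_Spaces.linear scale scale (\<lambda>x. bilin_ext f x y)"
  unfolding bilin_ext_def by (rule linear_lin_ext)

lemma bilin_ext_swap: "bilin_ext f x y = bilin_ext (\<lambda>b a. f a b) y x"
proof (rule poly_mapping_eqI)
  fix c
  show "Poly_Mapping.lookup (bilin_ext f x y) c = Poly_Mapping.lookup (bilin_ext (\<lambda>b a. f a b) y x) c"
    unfolding bilin_ext_def lin_ext_def lookup_sum lookup_scale sum_distrib_left
    by (subst sum.swap) (simp add: ac_simps)
qed

lemma linear_bilin_ext_right: "Vector_Spaces.linear scale scale (bilin_ext f x)"
proof -
  have "bilin_ext f x = (\<lambda>y. bilin_ext (\<lambda>b a. f a b) y x)"
    by (rule ext) (rule bilin_ext_swap)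
  then show ?thesis by (simp add: linear_bilin_ext_left)
qed

lemma linear_lin_ext_unique:
  assumes g: "Vector_Spaces.linear scale scale g"
  shows "g x = lin_ext (\<lambda>a. g (Poly_Mapping.single a 1)) x"
proof -
  interpret g: Vector_Spaces.linear scale scale g by fact
  have "x = (\<Sum>a\<in>Poly_Mapping.keys x. scale (Poly_Mapping.lookup x a) (Poly_Mapping.single a 1))"
    by (rule poly_mapping_eqI)
       (simp add: lookup_sum lookup_single when_def in_keys_iff if_distrib[where f="(*) _"] sum.delta cong: if_cong)
  then have "g x = g (\<Sum>a\<in>Poly_Mapping.keys x. scale (Poly_Mapping.lookup x a) (Poly_Mapping.single a 1))"
    by (rule arg_cong)
  also have "\<dots> = lin_ext (\<lambda>a. g (Poly_Mapping.single a 1)) x"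
    by (simp add: g.sum g.scale lin_ext_def)
  finally show ?thesis .
qed

lemma linear_eq_on_basis:
  assumes "Vector_Spaces.linear scale scale f" "Vector_Spaces.linear scale scale g"
    and "\<And>a. f (Poly_Mapping.single a 1) = g (Poly_Mapping.single a 1)"
  shows "f x = g x"
  using linear_lin_ext_unique[OF assms(1), of x] linear_lin_ext_unique[OF assms(2), of x] assms(3)
  by simp

lemma on_left_tensor:
  assumes h: "Vector_Spaces.linear scale scale h"
  shows "on_left h (y \<otimes> z) = h y \<otimes> z"
proof -
  note comp = Vector_Spaces.linear_compose[unfolded comp_def]
  have lin1: "Vector_Spaces.linear scale scale (\<lambda>y. on_left h (y \<otimes> z))" for z
    unfolding on_left_def tensor_def by (rule comp[OF linear_bilin_ext_left linear_lin_ext])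
  have lin2: "Vector_Spaces.linear scale scale (\<lambda>y. h y \<otimes> z)" for z
    unfolding tensor_def by (rule comp[OF h linear_bilin_ext_left])
  have lin3: "Vector_Spaces.linear scale scale (\<lambda>z. on_left h (y \<otimes> z))" for y
    unfolding on_left_def tensor_def by (rule comp[OF linear_bilin_ext_right linear_lin_ext])
  have lin4: "Vector_Spaces.linear scale scale (\<lambda>z. h y \<otimes> z)" for y
    unfolding tensor_def by (rule linear_bilin_ext_right)
  show ?thesis
    by (rule linear_eq_on_basis[OF lin1 lin2], rule linear_eq_on_basis[OF lin3 lin4])
       (simp add: on_left_def tensor_def)
qed

lemma on_right_tensor:
  assumes h: "Vector_Spaces.linear scale scale h"
  shows "on_right h (y \<otimes> z) = y \<otimes> h z"
proof -
  note comp = Vector_Spaces.linear_compose[unfolded comp_def]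
  have lin1: "Vector_Spaces.linear scale scale (\<lambda>y. on_right h (y \<otimes> z))" for z
    unfolding on_right_def tensor_def by (rule comp[OF linear_bilin_ext_left linear_lin_ext])
  have lin2: "Vector_Spaces.linear scale scale (\<lambda>y. y \<otimes> h z)" for z
    unfolding tensor_def by (rule linear_bilin_ext_left)
  have lin3: "Vector_Spaces.linear scale scale (\<lambda>z. on_right h (y \<otimes> z))" for y
    unfolding on_right_def tensor_def by (rule comp[OF linear_bilin_ext_right linear_lin_ext])
  have lin4: "Vector_Spaces.linear scale scale (\<lambda>z. y \<otimes> h z)" for y
    unfolding tensor_def by (rule comp[OF h linear_bilin_ext_right])
  show ?thesis
    by (rule linear_eq_on_basis[OF lin1 lin2], rule linear_eq_on_basis[OF lin3 lin4])
       (simp add: on_right_def tensor_def)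
qed


section \<open>The space M, its operations and the reduced deconcatenation\<close>

type_synonym 'k M = "nforest \<Rightarrow>\<^sub>0 'k"
type_synonym 'k MM = "nforest \<times> nforest \<Rightarrow>\<^sub>0 'k"

definition conc :: "'k::field M \<Rightarrow> 'k M \<Rightarrow> 'k M" (infixl "\<cdot>" 80) where
  "x \<cdot> y = bilin_ext conc_nf x y"

definition succ :: "'k::field M \<Rightarrow> 'k M \<Rightarrow> 'k M" (infixl "\<succ>" 80) where
  "x \<succ> y = bilin_ext succ_nf x y"

definition prec :: "'k::field M \<Rightarrow> 'k M \<Rightarrow> 'k M" (infixl "\<prec>" 80) where
  "x \<prec> y = bilin_ext prec_nf x y"

definition deconc :: "'k::field M \<Rightarrow> 'k MM" where
  "deconc = lin_ext (\<lambda>F. \<Sum>(F1, F2) | conc_nf F1 F2 = F.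
     Poly_Mapping.single F1 1 \<otimes> Poly_Mapping.single F2 1)"

text \<open>The index set of this sum is finite, so the sum is not the default value 0.\<close>

lemma finite_splits: "finite {(F1, F2). conc_nf F1 F2 = F}"
proof (rule inj_on_finite)
  let ?f = "\<lambda>(F1, F2). (Rep_nforest F1, Rep_nforest F2)"
  let ?S = "(\<lambda>n. (take n (Rep_nforest F), drop n (Rep_nforest F))) ` {..length (Rep_nforest F)}"
  show "inj_on ?f {(F1, F2). conc_nf F1 F2 = F}"
    by (auto simp: inj_on_def Rep_nforest_inject)
  show "?f ` {(F1, F2). conc_nf F1 F2 = F} \<subseteq> ?S"
  proof clarsimp
    fix F1 F2
    show "(Rep_nforest F1, Rep_nforest F2)
      \<in> (\<lambda>n. (take n (Rep_nforest (conc_nf F1 F2)), drop n (Rep_nforest (conc_nf F1 F2)))) `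
        {..length (Rep_nforest (conc_nf F1 F2))}"
      by (rule image_eqI[where x = "length (Rep_nforest F1)"]) (simp_all add: conc_nf.rep_eq)
  qed
  show "finite ?S" by simp
qed

text \<open>
  The conventions on tensors, each argument \<open>1\<close> being the formal unit:
  \<open>conc_left x t\<close> is \<open>(x \<otimes> 1) t\<close>, \<open>conc_right t y\<close> is \<open>t (1 \<otimes> y)\<close>,
  \<open>succ_left x t\<close> is \<open>(x \<otimes> 1) \<succ> t\<close> and \<open>prec_right t y\<close> is \<open>t \<prec> (1 \<otimes> y)\<close>.
\<close>

definition conc_left :: "'k::field M \<Rightarrow> 'k MM \<Rightarrow> 'k MM" where
  "conc_left x = on_left (\<lambda>z. x \<cdot> z)"

definition conc_right :: "'k::field MM \<Rightarrow> 'k M \<Rightarrow> 'k MM" where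
  "conc_right t y = on_right (\<lambda>z. z \<cdot> y) t"

definition succ_left :: "'k::field M \<Rightarrow> 'k MM \<Rightarrow> 'k MM" where
  "succ_left x = on_left (\<lambda>z. x \<succ> z)"

definition prec_right :: "'k::field MM \<Rightarrow> 'k M \<Rightarrow> 'k MM" where
  "prec_right t y = on_right (\<lambda>z. z \<prec> y) t"

lemma conc_left_tensor: "conc_left x (y' \<otimes> y'') = (x \<cdot> y') \<otimes> y''"
  unfolding conc_left_def conc_def by (rule on_left_tensor[OF linear_bilin_ext_right])

lemma conc_right_tensor: "conc_right (x' \<otimes> x'') y = x' \<otimes> (x'' \<cdot> y)"
  unfolding conc_right_def conc_def by (rule on_right_tensor[OF linear_bilin_ext_left])

lemma succ_left_tensor: "succ_left x (y' \<otimes> y'') = (x \<succ> y') \<otimes> y''"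
  unfolding succ_left_def succ_def by (rule on_left_tensor[OF linear_bilin_ext_right])

lemma prec_right_tensor: "prec_right (x' \<otimes> x'') y = x' \<otimes> (x'' \<prec> y)"
  unfolding prec_right_def prec_def by (rule on_right_tensor[OF linear_bilin_ext_left])

end

theory Submission
  imports Defs
begin

text \<open>
  All sides of the three identities are bilinear in \<open>x\<close> and \<open>y\<close>, so it is enough to compare
  them on nonempty forests \<open>G\<close> and \<open>F\<close>, where each becomes an identity between sums over
  the ways to cut a forest into two nonempty pieces.

  A cut of \<open>G F\<close> falls inside \<open>F\<close>, inside \<open>G\<close>, or exactly between them, and these
  alternatives exclude each other; they give the three terms of the first identity
  (\<open>splits_conc\<close>). The product \<open>G \<succ> F\<close> only changes the first tree of \<open>F\<close>, without changing
  the number of trees. It thus has a cut for each cut \<open>F1 F2\<close> of \<open>F\<close>, and the modified tree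
  lies in the left piece, which becomes \<open>G \<succ> F1\<close> (\<open>splits_succ\<close>). Symmetrically,
  \<open>G \<prec> F\<close> only changes the last tree of \<open>G\<close>, which lies in the right piece of each cut
  (\<open>splits_prec\<close>).
\<close>

section \<open>Reduction of bilinear identities to basis vectors\<close>

lemma linear_scaleI:
  fixes f :: "('a \<Rightarrow>\<^sub>0 'k::field) \<Rightarrow> ('b \<Rightarrow>\<^sub>0 'k)"
  assumes "\<And>x y. f (x + y) = f x + f y" "\<And>c x. f (scale c x) = scale c (f x)"
  shows "Vector_Spaces.linear scale scale f"
  using assms by (simp add: Vector_Spaces.linear_iff vector_space_scale)

lemma linear_scale_add:
  assumes "Vector_Spaces.linear scale scale f"
  shows "f (x + y) = f x + f y"
  using assms by (simp add: Vector_Spaces.linear_iff)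

lemma linear_scale_scale:
  assumes "Vector_Spaces.linear scale scale f"
  shows "f (scale c x) = scale c (f x)"
  using assms by (simp add: Vector_Spaces.linear_iff)

lemma linear_sum_fun:
  fixes f g :: "('a \<Rightarrow>\<^sub>0 'k::field) \<Rightarrow> ('b \<Rightarrow>\<^sub>0 'k)"
  assumes "Vector_Spaces.linear scale scale f" "Vector_Spaces.linear scale scale g"
  shows "Vector_Spaces.linear scale scale (\<lambda>x. f x + g x)"
  by (rule linear_scaleI; rule poly_mapping_eqI)
     (simp_all add: linear_scale_add[OF assms(1)] linear_scale_add[OF assms(2)]
        linear_scale_scale[OF assms(1)] linear_scale_scale[OF assms(2)] lookup_add algebra_simps)

text \<open>
  Operations such as \<open>(x \<otimes> 1) t\<close> are defined as linear extensions in \<open>t\<close>. They are linear in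
  \<open>x\<close> as well, because their values on basis tensors are.
\<close>

lemma linear_lin_ext_param:
  fixes g :: "'a \<Rightarrow> ('b \<Rightarrow>\<^sub>0 'k::field) \<Rightarrow> ('c \<Rightarrow>\<^sub>0 'k)"
  assumes "\<And>a. Vector_Spaces.linear scale scale (g a)"
  shows "Vector_Spaces.linear scale scale (\<lambda>x. lin_ext (\<lambda>a. g a x) t)"
  by (rule linear_scaleI; rule poly_mapping_eqI)
     (simp_all add: lin_ext_def lookup_sum lookup_add linear_scale_add[OF assms]
        linear_scale_scale[OF assms] algebra_simps sum.distrib sum_distrib_left)

lemma linear_on_left_param:
  assumes "\<And>z. Vector_Spaces.linear scale scale (\<lambda>x. h x z)"
  shows "Vector_Spaces.linear scale scale (\<lambda>x. on_left (h x) t)"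
  unfolding on_left_def split_def
  by (rule linear_lin_ext_param, unfold tensor_def,
      rule Vector_Spaces.linear_compose[unfolded comp_def, OF assms linear_bilin_ext_left])

lemma linear_on_right_param:
  assumes "\<And>z. Vector_Spaces.linear scale scale (\<lambda>x. h x z)"
  shows "Vector_Spaces.linear scale scale (\<lambda>x. on_right (h x) t)"
  unfolding on_right_def split_def
  by (rule linear_lin_ext_param, unfold tensor_def,
      rule Vector_Spaces.linear_compose[unfolded comp_def, OF assms linear_bilin_ext_right])

lemma bilinear_eq_on_basis:
  fixes f g :: "('a \<Rightarrow>\<^sub>0 'k::field) \<Rightarrow> ('b \<Rightarrow>\<^sub>0 'k) \<Rightarrow> ('c \<Rightarrow>\<^sub>0 'k)"
  assumes "\<And>y. Vector_Spaces.linear scale scale (\<lambda>x. f x y)"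
    and "\<And>x. Vector_Spaces.linear scale scale (f x)"
    and "\<And>y. Vector_Spaces.linear scale scale (\<lambda>x. g x y)"
    and "\<And>x. Vector_Spaces.linear scale scale (g x)"
    and "\<And>a b. f (Poly_Mapping.single a 1) (Poly_Mapping.single b 1)
      = g (Poly_Mapping.single a 1) (Poly_Mapping.single b 1)"
  shows "f x y = g x y"
  by (rule linear_eq_on_basis[OF assms(1,3)], rule linear_eq_on_basis[OF assms(2,4)], rule assms(5))


section \<open>Cuts of a forest into two nonempty pieces\<close>

definition splits :: "nforest \<Rightarrow> (nforest \<times> nforest) set" where
  "splits F = {(F1, F2). conc_nf F1 F2 = F}"

lemma finite_splits_set: "finite (splits F)"
  unfolding splits_def by (rule finite_splits)

lemma conc_nf_left_cancel: "conc_nf G F = conc_nf G F' \<longleftrightarrow> F = F'"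
  by transfer simp

lemma conc_nf_right_cancel: "conc_nf G F = conc_nf G' F \<longleftrightarrow> G = G'"
  by transfer simp

lemma conc_nf_assoc: "conc_nf (conc_nf F G) H = conc_nf F (conc_nf G H)"
  by transfer simp

text \<open>Concatenation with a nonempty forest changes the number of trees.\<close>

lemma conc_nf_neq: "conc_nf F G \<noteq> F" "conc_nf F G \<noteq> G"
  by (transfer, simp)+

text \<open>
  This is the comparison of two prefixes of the same list; the case of an empty overlap has
  to be separated, because the overlap \<open>U\<close> is a nonempty forest.
\<close>

lemma conc_nf_eq_conc_nf:
  assumes "conc_nf A C = conc_nf G F"
  obtains "A = G" "C = F"
    | U where "A = conc_nf G U" "F = conc_nf U C"
    | U where "G = conc_nf A U" "C = conc_nf U F"
proof -
  have "(A = G \<and> C = F) \<or> (\<exists>U. A = conc_nf G U \<and> F = conc_nf U C)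
      \<or> (\<exists>U. G = conc_nf A U \<and> C = conc_nf U F)"
    using assms by transfer (force simp: append_eq_append_conv2)
  then show thesis using that by blast
qed

lemma splits_conc:
  "splits (conc_nf G F) =
    (\<lambda>(F1, F2). (conc_nf G F1, F2)) ` splits F \<union>
    (\<lambda>(G1, G2). (G1, conc_nf G2 F)) ` splits G \<union> {(G, F)}"
proof
  show "splits (conc_nf G F) \<subseteq>
      (\<lambda>(F1, F2). (conc_nf G F1, F2)) ` splits F \<union>
      (\<lambda>(G1, G2). (G1, conc_nf G2 F)) ` splits G \<union> {(G, F)}"
    by (auto simp: splits_def image_iff elim!: conc_nf_eq_conc_nf)
qed (auto simp: splits_def conc_nf_assoc)

lemma succ_nf_conc: "succ_nf G (conc_nf F1 F2) = conc_nf (succ_nf G F1) F2"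
  by transfer simp

lemma prec_nf_conc: "prec_nf (conc_nf G1 G2) F = conc_nf G1 (prec_nf G2 F)"
  by transfer (simp add: butlast_append)

lemma succ_nf_inject: "succ_nf G F = succ_nf G F' \<longleftrightarrow> F = F'"
  by transfer (metis append_same_eq list.collapse list.inject same_append_eq tree.collapse tree.inject)

lemma prec_nf_inject: "prec_nf G F = prec_nf G' F \<longleftrightarrow> G = G'"
  by transfer (metis append_butlast_last_id append1_eq_conv append_same_eq tree.collapse tree.inject)

lemma splits_succ:
  "splits (succ_nf G F) = (\<lambda>(F1, F2). (succ_nf G F1, F2)) ` splits F"
proof -
  have "\<exists>F1. A = succ_nf G F1 \<and> conc_nf F1 C = F" if "conc_nf A C = succ_nf G F" for A C
    using that
  proof transfer
    fix A C G F :: "tree list"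
    assume "A \<noteq> []" "F \<noteq> []" and eq: "A @ C = B (G @ lpart (hd F)) (rpart (hd F)) # tl F"
    then obtain A' where "A = B (G @ lpart (hd F)) (rpart (hd F)) # A'" "tl F = A' @ C"
      by (cases A) auto
    with \<open>F \<noteq> []\<close> show "\<exists>F1\<in>{F. F \<noteq> []}.
        A = B (G @ lpart (hd F1)) (rpart (hd F1)) # tl F1 \<and> F1 @ C = F"
      by (intro bexI[of _ "hd F # A'"]) (auto simp flip: \<open>tl F = A' @ C\<close>)
  qed
  then show ?thesis by (fastforce simp: splits_def succ_nf_conc)
qed

lemma splits_prec:
  "splits (prec_nf G F) = (\<lambda>(G1, G2). (G1, prec_nf G2 F)) ` splits G"
proof -
  have "\<exists>G2. C = prec_nf G2 F \<and> conc_nf A G2 = G" if "conc_nf A C = prec_nf G F" for A C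
    using that
  proof transfer
    fix A C G F :: "tree list"
    assume "C \<noteq> []" "G \<noteq> []"
      and eq: "A @ C = butlast G @ [B (lpart (last G)) (rpart (last G) @ F)]"
    then obtain C' where "C = C' @ [B (lpart (last G)) (rpart (last G) @ F)]" "butlast G = A @ C'"
      by (cases C rule: rev_cases) auto
    with \<open>G \<noteq> []\<close> show "\<exists>G2\<in>{G. G \<noteq> []}.
        C = butlast G2 @ [B (lpart (last G2)) (rpart (last G2) @ F)] \<and> A @ G2 = G"
      by (intro bexI[of _ "C' @ [last G]"]) (auto simp flip: append_assoc \<open>butlast G = A @ C'\<close>)
  qed
  then show ?thesis by (fastforce simp: splits_def prec_nf_conc)
qed


section \<open>The reduced deconcatenation of forests\<close>

lemma deconc_single:
  "deconc (Poly_Mapping.single F (1::'k::field)) = (\<Sum>p\<in>splits F. Poly_Mapping.single p 1)"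
  by (simp add: deconc_def splits_def tensor_def split_def)

lemma lin_ext_sum_single:
  "lin_ext f (\<Sum>p\<in>P. Poly_Mapping.single p (1::'k::field)) = (\<Sum>p\<in>P. f p)"
proof (induction P rule: infinite_finite_induct)
  case (insert p P)
  then show ?case by (simp add: lin_ext_add)
qed (simp_all add: lin_ext_def)

text \<open>
  On basis forests, each of the four operations on tensors acts injectively on the left or
  on the right pieces of the cuts, so it only reindexes the sum.
\<close>

lemma on_left_deconc_single:
  assumes "\<And>a. h (Poly_Mapping.single a (1::'k::field)) = Poly_Mapping.single (k a) 1" and "inj k"
  shows "on_left h (deconc (Poly_Mapping.single F 1))
    = (\<Sum>p\<in>(\<lambda>(F1, F2). (k F1, F2)) ` splits F. Poly_Mapping.single p 1)"
proof -
  have "inj_on (\<lambda>(F1, F2). (k F1, F2)) (splits F)"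
    using \<open>inj k\<close> by (auto simp: inj_on_def)
  then show ?thesis
    by (simp add: on_left_def deconc_single lin_ext_sum_single assms(1) tensor_def split_def sum.reindex)
qed

lemma on_right_deconc_single:
  assumes "\<And>a. h (Poly_Mapping.single a (1::'k::field)) = Poly_Mapping.single (k a) 1" and "inj k"
  shows "on_right h (deconc (Poly_Mapping.single F 1))
    = (\<Sum>p\<in>(\<lambda>(F1, F2). (F1, k F2)) ` splits F. Poly_Mapping.single p 1)"
proof -
  have "inj_on (\<lambda>(F1, F2). (F1, k F2)) (splits F)"
    using \<open>inj k\<close> by (auto simp: inj_on_def)
  then show ?thesis
    by (simp add: on_right_def deconc_single lin_ext_sum_single assms(1) tensor_def split_def sum.reindex)
qed

lemma deconc_conc_single:
  fixes G F :: nforest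
  defines "x \<equiv> Poly_Mapping.single G (1::'k::field)" and "y \<equiv> Poly_Mapping.single F (1::'k)"
  shows "deconc (x \<cdot> y) = conc_left x (deconc y) + conc_right (deconc x) y + x \<otimes> y"
proof -
  let ?L = "(\<lambda>(F1, F2). (conc_nf G F1, F2)) ` splits F"
  let ?R = "(\<lambda>(G1, G2). (G1, conc_nf G2 F)) ` splits G"
  have l: "conc_left x (deconc y) = (\<Sum>p\<in>?L. Poly_Mapping.single p 1)"
    unfolding conc_left_def x_def y_def
    by (rule on_left_deconc_single) (simp_all add: conc_def inj_def conc_nf_left_cancel)
  have r: "conc_right (deconc x) y = (\<Sum>p\<in>?R. Poly_Mapping.single p 1)"
    unfolding conc_right_def x_def y_def
    by (rule on_right_deconc_single) (simp_all add: conc_def inj_def conc_nf_right_cancel)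
  \<comment> \<open>A cut inside \<open>F\<close> has a left piece longer than \<open>G\<close>, and a cut inside \<open>G\<close> a shorter one.\<close>
  have "?L \<inter> ?R = {}"
    by (auto simp: splits_def conc_nf_assoc conc_nf_neq)
  moreover have "(G, F) \<notin> ?L \<union> ?R"
    by (auto simp: conc_nf_neq dest: sym)
  ultimately show ?thesis
    unfolding l r by (simp add: x_def y_def conc_def tensor_def deconc_single splits_conc
        finite_splits_set sum.union_disjoint add.commute del: Un_insert_right)
qed

lemma deconc_succ_single:
  fixes G F :: nforest
  defines "x \<equiv> Poly_Mapping.single G (1::'k::field)" and "y \<equiv> Poly_Mapping.single F (1::'k)"
  shows "deconc (x \<succ> y) = succ_left x (deconc y)"
proof -
  have "succ_left x (deconc y) = (\<Sum>p\<in>splits (succ_nf G F). Poly_Mapping.single p 1)"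
    unfolding succ_left_def x_def y_def splits_succ
    by (rule on_left_deconc_single) (simp_all add: succ_def inj_def succ_nf_inject)
  then show ?thesis by (simp add: x_def y_def succ_def deconc_single)
qed

lemma deconc_prec_single:
  fixes G F :: nforest
  defines "x \<equiv> Poly_Mapping.single G (1::'k::field)" and "y \<equiv> Poly_Mapping.single F (1::'k)"
  shows "deconc (x \<prec> y) = prec_right (deconc x) y"
proof -
  have "prec_right (deconc x) y = (\<Sum>p\<in>splits (prec_nf G F). Poly_Mapping.single p 1)"
    unfolding prec_right_def x_def y_def splits_prec
    by (rule on_right_deconc_single) (simp_all add: prec_def inj_def prec_nf_inject)
  then show ?thesis by (simp add: x_def y_def prec_def deconc_single)
qed


section \<open>Compatibility of the deconcatenation with the three products\<close>

theorem proposition54: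
  fixes x y :: "'k::field M"
  shows "deconc (x \<cdot> y) = conc_left x (deconc y) + conc_right (deconc x) y + x \<otimes> y
    \<and> deconc (x \<succ> y) = succ_left x (deconc y)
    \<and> deconc (x \<prec> y) = prec_right (deconc x) y"
proof (intro conjI)
  note lin = linear_bilin_ext_left linear_bilin_ext_right
    linear_on_left_param linear_on_right_param
  note comp = Vector_Spaces.linear_compose[unfolded comp_def]
  have dc: "Vector_Spaces.linear scale scale (deconc :: 'k M \<Rightarrow> 'k MM)"
    unfolding deconc_def by (rule linear_lin_ext)
  have left: "Vector_Spaces.linear scale scale (\<lambda>y :: 'k M. on_left h (deconc y))"
    for h :: "'k M \<Rightarrow> 'k M"
    unfolding on_left_def by (rule comp[OF dc linear_lin_ext])
  have right: "Vector_Spaces.linear scale scale (\<lambda>x :: 'k M. on_right h (deconc x))"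
    for h :: "'k M \<Rightarrow> 'k M"
    unfolding on_right_def by (rule comp[OF dc linear_lin_ext])
  have prod1: "Vector_Spaces.linear scale scale (\<lambda>x :: 'k M. deconc (bilin_ext f x y))" for f and y :: "'k M"
    by (rule comp[OF linear_bilin_ext_left dc])
  have prod2: "Vector_Spaces.linear scale scale (\<lambda>y :: 'k M. deconc (bilin_ext f x y))" for f and x :: "'k M"
    by (rule comp[OF linear_bilin_ext_right dc])
  show "deconc (x \<cdot> y) = conc_left x (deconc y) + conc_right (deconc x) y + x \<otimes> y"
  proof (rule bilinear_eq_on_basis[where f = "\<lambda>x y. deconc (x \<cdot> y)"
        and g = "\<lambda>x y. conc_left x (deconc y) + conc_right (deconc x) y + x \<otimes> y"])
    fix z :: "'k M"
    show "Vector_Spaces.linear scale scale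
        (\<lambda>x. conc_left x (deconc z) + conc_right (deconc x) z + x \<otimes> z)"
      unfolding conc_left_def conc_right_def conc_def tensor_def
      by (intro linear_sum_fun right lin)
    show "Vector_Spaces.linear scale scale
        (\<lambda>y. conc_left z (deconc y) + conc_right (deconc z) y + z \<otimes> y)"
      unfolding conc_left_def conc_right_def conc_def tensor_def
      by (intro linear_sum_fun left lin)
  qed (unfold conc_def, (rule prod1 prod2 deconc_conc_single[unfolded conc_def])+)
  show "deconc (x \<succ> y) = succ_left x (deconc y)"
    by (rule bilinear_eq_on_basis[where f = "\<lambda>x y. deconc (x \<succ> y)"
          and g = "\<lambda>x y. succ_left x (deconc y)"])
       (unfold succ_left_def succ_def, (rule prod1 prod2 left linear_on_left_param
          linear_bilin_ext_left deconc_succ_single[unfolded succ_left_def succ_def])+)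
  show "deconc (x \<prec> y) = prec_right (deconc x) y"
    by (rule bilinear_eq_on_basis[where f = "\<lambda>x y. deconc (x \<prec> y)"
          and g = "\<lambda>x y. prec_right (deconc x) y"])
       (unfold prec_right_def prec_def, (rule prod1 prod2 right linear_on_right_param
          linear_bilin_ext_right deconc_prec_single[unfolded prec_right_def prec_def])+)
qed

end
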